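(* Let $G$ and $H$ be finite simple graphs with nonempty vertex sets. If $G$ and $H$ are homomorphically equivalent, then $\alpha^o(G)=\alpha^o(H)$.
   Context: All graphs are simple, with finite and nonempty vertex set; $V(G)$ and $E(G)$ denote the vertex set and edge set of $G$. Circular altitude: a linear ordering of $V(G)$ is a bijection $\mathcal{U}:\{1,2,\ldots,|V(G)|\}\to V(G)$; write $u_i=\mathcal{U}(i)$. A $\mathcal{U}$-monotonic cycle of length $m$ ($m\ge 1$) is a sequence $u_{i_1},u_{i_2},\ldots,u_{i_m}$ of $m$ pairwise distinct vertices of $G$ such that, whenever $m>1$: (i) $i_1<i_2<\cdots<i_m$; (ii) $u_{i_t}$ and $u_{i_{t+1}}$ are adjacent for each $1\le t\le m-1$; (iii) $u_{i_m}$ and $u_{i_1}$ are adjacent. (So a single vertex is a monotonic cycle of length $1$, and an edge gives one of length $2$.) Let $|\mathcal{U}|$ denote the maximum length of a $\mathcal{U}$-monotonic cycle. The circular altitude $\alpha^o(G)$ is the minimum of $|\mathcal{U}|$ over all linear orderings $\mathcal{U}$ of $V(G)$. Homomorphisms: a homomorphism from $G$ to $H$ is a function $f:V(G)\to V(H)$ such that $xy\in E(G)$ implies $f(x)f(y)\in E(H)$ for all $x,y\in V(G)$. $G$ and $H$ are homomorphically equivalent if there exist a homomorphism from $G$ to $H$ and a homomorphism from $H$ to $G$. *)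

theory Defs
  imports "Graph_Theory.Pair_Digraph"
begin

text \<open>
  Finite simple graphs are modelled by the locale \<^locale>\<open>pair_graph\<close>: a finite vertex set
  together with a symmetric, irreflexive relation on it. An edge between \<open>x\<close> and \<open>y\<close> is thus
  the pair of arcs \<open>(x, y)\<close> and \<open>(y, x)\<close>. The locale admits the null graph, so nonemptiness
  of the vertex set has to be required separately.
\<close>

definition linear_ordering :: "'a pair_pre_digraph \<Rightarrow> (nat \<Rightarrow> 'a) \<Rightarrow> bool" where
  "linear_ordering G U \<longleftrightarrow> bij_betw U {1..card (pverts G)} (pverts G)"

text \<open>
  The list \<open>js\<close> holds the indices of the vertices of the cycle \<open>c\<close>. Despite the name, single
  vertices and single edges count as cycles, of lengths 1 and 2.
\<close>

definition monotonic_cycle :: "'a pair_pre_digraph \<Rightarrow> (nat \<Rightarrow> 'a) \<Rightarrow> 'a list \<Rightarrow> bool" where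
  "monotonic_cycle G U c \<longleftrightarrow>
     c \<noteq> [] \<and> distinct c \<and>
     (\<exists>js. set js \<subseteq> {1..card (pverts G)} \<and> c = map U js \<and>
        (length c > 1 \<longrightarrow>
           sorted_wrt (<) js \<and>
           successively (\<lambda>x y. (x, y) \<in> parcs G) c \<and>
           (last c, hd c) \<in> parcs G))"

definition ordering_length :: "'a pair_pre_digraph \<Rightarrow> (nat \<Rightarrow> 'a) \<Rightarrow> nat" where
  "ordering_length G U = Max {length c | c. monotonic_cycle G U c}"

definition circular_altitude :: "'a pair_pre_digraph \<Rightarrow> nat" where
  "circular_altitude G = Min {ordering_length G U | U. linear_ordering G U}"

definition graph_hom :: "'a pair_pre_digraph \<Rightarrow> 'b pair_pre_digraph \<Rightarrow> ('a \<Rightarrow> 'b) \<Rightarrow> bool" where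
  "graph_hom G H f \<longleftrightarrow>
     f \<in> pverts G \<rightarrow> pverts H \<and>
     (\<forall>x\<in>pverts G. \<forall>y\<in>pverts G. (x, y) \<in> parcs G \<longrightarrow> (f x, f y) \<in> parcs H)"

definition hom_equivalent :: "'a pair_pre_digraph \<Rightarrow> 'b pair_pre_digraph \<Rightarrow> bool" where
  "hom_equivalent G H \<longleftrightarrow> (\<exists>f. graph_hom G H f) \<and> (\<exists>g. graph_hom H G g)"

text \<open>
  The sets under \<^const>\<open>Max\<close> and \<^const>\<open>Min\<close> above are finite and nonempty, so that
  these denote the actual maximum and minimum.
\<close>

lemma linear_ordering_exists:
  assumes "finite (pverts G)"
  shows "\<exists>U. linear_ordering G U"
  unfolding linear_ordering_def using ex_bij_betw_nat_finite_1[OF assms] by auto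

lemma monotonic_cycle_length_le:
  assumes "finite (pverts G)" "linear_ordering G U" "monotonic_cycle G U c"
  shows "length c \<le> card (pverts G)"
proof -
  have "U ` {1..card (pverts G)} = pverts G"
    using assms(2) by (simp add: linear_ordering_def bij_betw_def)
  moreover obtain js where "set js \<subseteq> {1..card (pverts G)}" "c = map U js"
    using assms(3) unfolding monotonic_cycle_def by blast
  ultimately have "set c \<subseteq> pverts G"
    by (metis image_mono set_map)
  moreover have "distinct c"
    using assms(3) by (simp add: monotonic_cycle_def)
  ultimately show ?thesis
    using assms(1) by (metis card_mono distinct_card)
qed

lemma finite_monotonic_cycle_lengths:
  assumes "finite (pverts G)" "linear_ordering G U"
  shows "finite {length c | c. monotonic_cycle G U c}"
  by (rule finite_subset[of _ "{..card (pverts G)}"])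
     (use monotonic_cycle_length_le[OF assms] in auto)

lemma monotonic_cycle_singleton:
  assumes "j \<in> {1..card (pverts G)}"
  shows "monotonic_cycle G U [U j]"
  unfolding monotonic_cycle_def using assms by (auto intro: exI[of _ "[j]"])

lemma monotonic_cycle_lengths_nonempty:
  assumes "finite (pverts G)" "pverts G \<noteq> {}"
  shows "{length c | c. monotonic_cycle G U c} \<noteq> {}"
proof -
  have "1 \<in> {1..card (pverts G)}"
    using assms by (simp add: Suc_le_eq card_gt_0_iff)
  from monotonic_cycle_singleton[OF this] show ?thesis by blast
qed

lemma ordering_length_le:
  assumes "finite (pverts G)" "pverts G \<noteq> {}" "linear_ordering G U"
  shows "ordering_length G U \<le> card (pverts G)"
  unfolding ordering_length_def
  using finite_monotonic_cycle_lengths[OF assms(1,3)]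
    monotonic_cycle_lengths_nonempty[OF assms(1,2), of U]
    monotonic_cycle_length_le[OF assms(1,3)]
  by (subst Max_le_iff) auto

lemma finite_ordering_lengths:
  assumes "finite (pverts G)" "pverts G \<noteq> {}"
  shows "finite {ordering_length G U | U. linear_ordering G U}"
  by (rule finite_subset[of _ "{..card (pverts G)}"]) (use ordering_length_le[OF assms] in auto)

lemma ordering_lengths_nonempty:
  assumes "finite (pverts G)"
  shows "{ordering_length G U | U. linear_ordering G U} \<noteq> {}"
  using linear_ordering_exists[OF assms] by blast

end

theory Submission
  imports Defs
begin

text \<open>
  Pull an ordering of \<open>H\<close> back along a homomorphism from \<open>G\<close>: order the vertices of \<open>G\<close> by the
  position of their image, breaking ties arbitrarily. Adjacent vertices of \<open>G\<close> have distinct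
  images since \<open>H\<close> has no loops, so the image of a monotonic cycle again has strictly increasing
  positions and is a monotonic cycle of the same length. Hence circular altitude does not
  decrease along homomorphisms.
\<close>

lemma bij_betw_nat_mono_key:
  fixes k :: "'a \<Rightarrow> 'b :: linorder"
  assumes "finite A"
  obtains U where "bij_betw U {1..card A} A"
    and "\<And>i j. \<lbrakk>1 \<le> i; i \<le> j; j \<le> card A\<rbrakk> \<Longrightarrow> k (U i) \<le> k (U j)"
proof -
  obtain xs where xs: "set xs = A" "distinct xs"
    using finite_distinct_list[OF assms] by blast
  \<comment> \<open>Sorting a duplicate-free enumeration of \<open>A\<close> by \<open>k\<close>
    makes the keys weakly increasing; elements with equal keys keep the order they have in
    \<open>xs\<close>.\<close>
  define ys where "ys = sort_key k xs"
  have ys: "set ys = A" "distinct ys" "length ys = card A"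
    using xs distinct_card[of xs] by (auto simp: ys_def)
  \<comment> \<open>Orderings are indexed from 1 and lists from 0, so the positions are shifted down
    by one.\<close>
  have "bij_betw (\<lambda>i. i - 1) {1..card A} {..<card A}"
    by (rule bij_betw_byWitness[where f' = Suc]) auto
  moreover have "bij_betw ((!) ys) {..<card A} A"
    by (rule bij_betw_nth[OF ys(2)]) (simp_all only: ys)
  ultimately have "bij_betw ((!) ys \<circ> (\<lambda>i. i - 1)) {1..card A} A"
    by (rule bij_betw_trans)
  moreover have "k (ys ! (i - 1)) \<le> k (ys ! (j - 1))"
    if "1 \<le> i" "i \<le> j" "j \<le> card A" for i j
  proof -
    have "sorted (map k ys)"
      by (simp add: ys_def)
    from sorted_nth_mono[OF this, of "i - 1" "j - 1"] show ?thesis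
      using that ys(3) by simp
  qed
  ultimately show ?thesis
    by (intro that[of "(!) ys \<circ> (\<lambda>i. i - 1)"]) auto
qed

text \<open>The function \<open>inv_into {1..card (pverts H)} U\<close> gives the position of a
  vertex in \<open>U\<close>. The length bound is what releases the order and adjacency conditions
  from the definition of \<open>monotonic_cycle\<close>.\<close>

lemma monotonic_cycle_image:
  assumes "pair_graph H" "graph_hom G H f"
    and U: "linear_ordering H U" and V: "linear_ordering G V"
    and mono: "\<And>i j. \<lbrakk>1 \<le> i; i \<le> j; j \<le> card (pverts G)\<rbrakk> \<Longrightarrow>
      inv_into {1..card (pverts H)} U (f (V i)) \<le> inv_into {1..card (pverts H)} U (f (V j))"
    and c: "monotonic_cycle G V c" "length c > 1"
  shows "monotonic_cycle H U (map f c)"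
proof -
  let ?I = "{1..card (pverts H)}"
  define k where "k x = inv_into ?I U (f x)" for x
  have loopfree: "(x, y) \<in> parcs H \<Longrightarrow> x \<noteq> y" for x y
    using pair_loopfree_digraph.pair_no_loops[of H "(x, y)"] assms(1)
    by (simp add: pair_graph_def pair_digraph_def)
  have bU: "bij_betw U ?I (pverts H)"
    using U by (simp add: linear_ordering_def)
  have V_in: "V i \<in> pverts G" if "i \<in> {1..card (pverts G)}" for i
    using V that by (auto simp: linear_ordering_def dest: bij_betwE)
  have f_in: "f x \<in> pverts H" if "x \<in> pverts G" for x
    using assms(2) that by (auto simp: graph_hom_def)
  have f_arc: "(f x, f y) \<in> parcs H"
    if "(x, y) \<in> parcs G" "x \<in> pverts G" "y \<in> pverts G" for x y
    using assms(2) that by (auto simp: graph_hom_def)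
  have k_in: "k x \<in> ?I" and U_k: "U (k x) = f x" if "x \<in> pverts G" for x
    using f_in[OF that] bU unfolding k_def
    by (metis bij_betw_imp_surj_on inv_into_into, metis bij_betw_inv_into_right)
  obtain js where js: "set js \<subseteq> {1..card (pverts G)}" "c = map V js" "sorted_wrt (<) js"
    and suc: "successively (\<lambda>x y. (x, y) \<in> parcs G) c" and close: "(last c, hd c) \<in> parcs G"
    using c unfolding monotonic_cycle_def by blast
  have c_in: "set c \<subseteq> pverts G"
    using js(1,2) V_in by auto
  have suc': "successively (\<lambda>x y. (x, y) \<in> parcs H) (map f c)"
    unfolding successively_map
    by (rule successively_mono[OF suc]) (use c_in f_arc in auto)
  \<comment> \<open>Only neighbours on the cycle are compared, because only they are known to have
    distinct images; transitivity of \<open><\<close> then separates all the others.\<close>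
  have "successively (<) (map k c)"
    unfolding successively_conv_nth
  proof (intro allI impI)
    fix i assume i: "Suc i < length (map k c)"
    then have in_range: "js ! i \<in> {1..card (pverts G)}" "js ! Suc i \<in> {1..card (pverts G)}"
      using js(1,2) by (auto simp del: atLeastAtMost_iff intro!: subsetD[OF js(1)])
    have "js ! i < js ! Suc i"
      using i js(2,3) by (simp add: sorted_wrt_iff_nth_less)
    then have le: "k (c ! i) \<le> k (c ! Suc i)"
      using mono[of "js ! i" "js ! Suc i"] in_range i js(2) by (simp add: k_def)
    \<comment> \<open>An arc of the loop-free \<open>H\<close> joins the two images, which upgrades
      the weak inequality \<open>le\<close> to a strict one.\<close>
    have "(f (c ! i), f (c ! Suc i)) \<in> parcs H"
      using suc' i by (auto simp: successively_conv_nth)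
    then have "f (c ! i) \<noteq> f (c ! Suc i)"
      by (rule loopfree)
    moreover have "c ! i \<in> pverts G" "c ! Suc i \<in> pverts G"
      using i c_in by (auto intro!: subsetD[OF c_in])
    ultimately have "k (c ! i) \<noteq> k (c ! Suc i)"
      using U_k by metis
    then show "map k c ! i < map k c ! Suc i"
      using le i by simp
  qed
  then have sorted: "sorted_wrt (<) (map k c)"
    by (simp add: successively_conv_sorted_wrt)
  have k_sub: "set (map k c) \<subseteq> ?I"
    using c_in k_in by (auto simp del: atLeastAtMost_iff)
  \<comment> \<open>This presents \<open>map k c\<close> as the index list that the definition of
    \<open>monotonic_cycle\<close> asks for.\<close>
  have eq: "map f c = map U (map k c)"
    using c_in U_k by auto
  \<comment> \<open>The map \<open>f\<close> may identify vertices of \<open>G\<close>; distinctness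
    along the cycle comes from the strictly increasing positions and the injectivity of
    \<open>U\<close> on them.\<close>
  have "distinct (map f c)"
    unfolding eq distinct_map[of U]
    using sorted inj_on_subset[OF bij_betw_imp_inj_on[OF bU] k_sub]
    by (simp add: strict_sorted_iff)
  moreover have "c \<noteq> []"
    using c(2) by auto
  moreover from this have "(last (map f c), hd (map f c)) \<in> parcs H"
    using c_in close f_arc[of "last c" "hd c"] by (simp add: last_map hd_map subset_iff)
  ultimately show ?thesis
    unfolding monotonic_cycle_def using suc' sorted k_sub eq
    by blast
qed

lemma ordering_length_pullback:
  assumes G: "finite (pverts G)" "pverts G \<noteq> {}" and H: "pair_graph H" "pverts H \<noteq> {}"
    and hom: "graph_hom G H f" and U: "linear_ordering H U"
  shows "\<exists>V. linear_ordering G V \<and> ordering_length G V \<le> ordering_length H U"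
proof -
  have finH: "finite (pverts H)"
    using H(1) by (simp add: pair_graph_def pair_digraph_def pair_fin_digraph.pair_finite_verts)
  obtain V where bV: "bij_betw V {1..card (pverts G)} (pverts G)"
    and mono: "\<And>i j. \<lbrakk>1 \<le> i; i \<le> j; j \<le> card (pverts G)\<rbrakk> \<Longrightarrow>
      inv_into {1..card (pverts H)} U (f (V i)) \<le> inv_into {1..card (pverts H)} U (f (V j))"
    using bij_betw_nat_mono_key[OF G(1), of "\<lambda>x. inv_into {1..card (pverts H)} U (f x)"] by blast
  from bV have V: "linear_ordering G V"
    by (simp add: linear_ordering_def)
  have le: "length d \<le> ordering_length H U" if "monotonic_cycle H U d" for d
    unfolding ordering_length_def
    using that by (intro Max_ge finite_monotonic_cycle_lengths[OF finH U]) auto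
  have "length c \<le> ordering_length H U" if c: "monotonic_cycle G V c" for c
  proof (cases "length c > 1")
    case True
    then show ?thesis
      using le[OF monotonic_cycle_image[OF H(1) hom U V mono c]] by simp
  next
    case False
    \<comment> \<open>A one-vertex cycle is matched by the one-vertex cycle at position 1 of
      \<open>U\<close>, which exists as \<open>H\<close> is nonempty.\<close>
    have "1 \<in> {1..card (pverts H)}"
      using finH H(2) by (simp add: Suc_le_eq card_gt_0_iff)
    from le[OF monotonic_cycle_singleton[OF this]] False show ?thesis
      by simp
  qed
  then have "ordering_length G V \<le> ordering_length H U"
    unfolding ordering_length_def[of G]
    using finite_monotonic_cycle_lengths[OF G(1) V] monotonic_cycle_lengths_nonempty[OF G]
    by (subst Max_le_iff) auto
  with V show ?thesis by blast
qed

text \<open>Pulling back an ordering of \<open>H\<close> that attains the minimum yields an ordering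
  of \<open>G\<close> that is no longer, and this bounds the minimum for \<open>G\<close>.\<close>

lemma circular_altitude_hom_mono:
  assumes G: "finite (pverts G)" "pverts G \<noteq> {}" and H: "pair_graph H" "pverts H \<noteq> {}"
    and hom: "graph_hom G H f"
  shows "circular_altitude G \<le> circular_altitude H"
proof -
  have finH: "finite (pverts H)"
    using H(1) by (simp add: pair_graph_def pair_digraph_def pair_fin_digraph.pair_finite_verts)
  have "circular_altitude H \<in> {ordering_length H U | U. linear_ordering H U}"
    unfolding circular_altitude_def
    by (rule Min_in[OF finite_ordering_lengths[OF finH H(2)] ordering_lengths_nonempty[OF finH]])
  then obtain U where U: "linear_ordering H U" "circular_altitude H = ordering_length H U"
    by blast
  obtain V where V: "linear_ordering G V" "ordering_length G V \<le> ordering_length H U"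
    using ordering_length_pullback[OF G H hom U(1)] by blast
  have "circular_altitude G \<le> ordering_length G V"
    unfolding circular_altitude_def
    using V(1) by (intro Min_le finite_ordering_lengths[OF G]) auto
  then show ?thesis
    using V(2) U(2) by simp
qed

theorem theorem2:
  fixes G :: "'a pair_pre_digraph" and H :: "'b pair_pre_digraph"
  assumes "pair_graph G" and "pverts G \<noteq> {}"
    and "pair_graph H" and "pverts H \<noteq> {}"
    and "hom_equivalent G H"
  shows "circular_altitude G = circular_altitude H"
proof -
  have "finite (pverts G)" "finite (pverts H)"
    using assms(1,3) by (simp_all add: pair_graph_def pair_digraph_def pair_fin_digraph.pair_finite_verts)
  with assms show ?thesis
    \<comment> \<open>Monotonicity is applied once to each of the two homomorphisms.\<close>
    unfolding hom_equivalent_def by (metis circular_altitude_hom_mono order_antisym)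
qed

end
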